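(* Let $L$ be a finite-dimensional dually atomistic restricted Lie algebra over an algebraically closed field $\mathbb{F}$ of characteristic $p>0$. Then $L$ is solvable or semisimple.
   Context: All algebras are finite-dimensional. A restricted Lie algebra $L$ is dually atomistic if every restricted subalgebra of $L$ is an intersection of maximal restricted subalgebras of $L$ (with $L$ itself regarded as the empty intersection). A maximal restricted subalgebra is one that is maximal among the proper restricted subalgebras. Semisimple means that the solvable radical (the maximal solvable ideal) is zero. *)

theory Defs
  imports Complex_Main "HOL-Computational_Algebra.Computational_Algebra"
begin

locale lie_algebra = vector_space scale
  for scale :: "'f::field \<Rightarrow> 'l::ab_group_add \<Rightarrow> 'l" (infixr \<open>*s\<close> 75) +
  fixes bracket :: "'l \<Rightarrow> 'l \<Rightarrow> 'l"  (\<open>\<lbrakk>_,/ _\<rbrakk>\<close>)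
  assumes bracket_add_left: "\<lbrakk>x + y, z\<rbrakk> = \<lbrakk>x, z\<rbrakk> + \<lbrakk>y, z\<rbrakk>"
    and bracket_add_right: "\<lbrakk>x, y + z\<rbrakk> = \<lbrakk>x, y\<rbrakk> + \<lbrakk>x, z\<rbrakk>"
    and bracket_scale_left: "\<lbrakk>a *s x, y\<rbrakk> = a *s \<lbrakk>x, y\<rbrakk>"
    and bracket_scale_right: "\<lbrakk>x, a *s y\<rbrakk> = a *s \<lbrakk>x, y\<rbrakk>"
    and bracket_self: "\<lbrakk>x, x\<rbrakk> = 0"
    and jacobi: "\<lbrakk>x, \<lbrakk>y, z\<rbrakk>\<rbrakk> + \<lbrakk>y, \<lbrakk>z, x\<rbrakk>\<rbrakk> + \<lbrakk>z, \<lbrakk>x, y\<rbrakk>\<rbrakk> = 0"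
begin

definition subalgebra :: "'l set \<Rightarrow> bool" where
  "subalgebra S \<longleftrightarrow> subspace S \<and> (\<forall>x\<in>S. \<forall>y\<in>S. \<lbrakk>x, y\<rbrakk> \<in> S)"

definition ideal :: "'l set \<Rightarrow> bool" where
  "ideal I \<longleftrightarrow> subspace I \<and> (\<forall>x. \<forall>y\<in>I. \<lbrakk>x, y\<rbrakk> \<in> I)"

definition derived_algebra :: "'l set \<Rightarrow> 'l set" where
  "derived_algebra S = span {\<lbrakk>x, y\<rbrakk> | x y. x \<in> S \<and> y \<in> S}"

definition solvable :: "'l set \<Rightarrow> bool" where
  "solvable S \<longleftrightarrow> (\<exists>n. (derived_algebra ^^ n) S = {0})"

text \<open>Greatest with respect to inclusion; it exists in finite dimension, as shown in
  \<open>finite_dimensional_lie_algebra\<close> below.\<close>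

definition solvable_radical :: "'l set" where
  "solvable_radical = (GREATEST I. ideal I \<and> solvable I)"

definition semisimple :: bool where
  "semisimple \<longleftrightarrow> solvable_radical = {0}"

text \<open>The Lie algebra \<open>L \<otimes> F[t]\<close> is represented by polynomials in \<open>t\<close> with coefficients in \<open>L\<close>;
  this is \<open>ad (t x + y)\<close> on it.\<close>

definition ad_pencil :: "'l \<Rightarrow> 'l \<Rightarrow> 'l poly \<Rightarrow> 'l poly" where
  "ad_pencil x y q = pCons 0 (map_poly (bracket x) q) + map_poly (bracket y) q"

text \<open>Jacobson's terms \<open>s\<^sub>i(x, y)\<close>, for \<open>1 \<le> i \<le> p - 1\<close> where \<open>p\<close> is the characteristic:
  \<open>i s\<^sub>i(x, y)\<close> is the coefficient of \<open>t\<close> to the power \<open>i - 1\<close> in \<open>ad (t x + y)\<close>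
  applied \<open>p - 1\<close> times to \<open>x\<close>.\<close>

definition jacobson_term :: "nat \<Rightarrow> 'l \<Rightarrow> 'l \<Rightarrow> 'l" where
  "jacobson_term i x y =
     inverse (of_nat i) *s coeff ((ad_pencil x y ^^ (CHAR('f) - 1)) [:x:]) (i - 1)"

end

locale restricted_lie_algebra = lie_algebra scale bracket
  for scale :: "'f::field \<Rightarrow> 'l::ab_group_add \<Rightarrow> 'l" (infixr \<open>*s\<close> 75)
    and bracket :: "'l \<Rightarrow> 'l \<Rightarrow> 'l"  (\<open>\<lbrakk>_,/ _\<rbrakk>\<close>) +
  fixes pmap :: "'l \<Rightarrow> 'l"
  assumes char_pos: "CHAR('f) > 0"
    and ad_pmap: "\<lbrakk>pmap x, y\<rbrakk> = (bracket x ^^ CHAR('f)) y"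
    and pmap_scale: "pmap (a *s x) = a ^ CHAR('f) *s pmap x"
    and pmap_add: "pmap (x + y) = pmap x + pmap y + (\<Sum>i = 1..<CHAR('f). jacobson_term i x y)"
begin

definition restricted_subalgebra :: "'l set \<Rightarrow> bool" where
  "restricted_subalgebra S \<longleftrightarrow> subalgebra S \<and> (\<forall>x\<in>S. pmap x \<in> S)"

definition maximal_restricted_subalgebra :: "'l set \<Rightarrow> bool" where
  "maximal_restricted_subalgebra M \<longleftrightarrow>
     restricted_subalgebra M \<and> M \<noteq> UNIV \<and>
     (\<forall>S. restricted_subalgebra S \<and> M \<subseteq> S \<and> S \<noteq> UNIV \<longrightarrow> S = M)"

text \<open>For \<open>\<M> = {}\<close> the intersection is \<open>UNIV\<close>, that is, the whole algebra.\<close>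

definition dually_atomistic :: bool where
  "dually_atomistic \<longleftrightarrow>
     (\<forall>S. restricted_subalgebra S \<longrightarrow>
        (\<exists>\<M>. (\<forall>M\<in>\<M>. maximal_restricted_subalgebra M) \<and> S = \<Inter>\<M>))"

end

locale finite_dimensional_lie_algebra =
  lie_algebra scale bracket + finite_dimensional_vector_space scale Basis
  for scale :: "'f::field \<Rightarrow> 'l::ab_group_add \<Rightarrow> 'l" (infixr \<open>*s\<close> 75)
    and bracket :: "'l \<Rightarrow> 'l \<Rightarrow> 'l"  (\<open>\<lbrakk>_,/ _\<rbrakk>\<close>)
    and Basis :: "'l set"
begin

lemma bracket_zero_left [simp]: "\<lbrakk>0, x\<rbrakk> = 0"
  using bracket_add_left[of 0 0 x] by simp

lemma bracket_zero_right [simp]: "\<lbrakk>x, 0\<rbrakk> = 0"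
  using bracket_add_right[of x 0 0] by simp

lemma bracket_anti: "\<lbrakk>x, y\<rbrakk> = - \<lbrakk>y, x\<rbrakk>"
  using bracket_self[of "x + y"] bracket_self[of x] bracket_self[of y]
  by (simp add: bracket_add_left bracket_add_right eq_neg_iff_add_eq_0 add.commute)

lemma derived_algebra_mono: "S \<subseteq> T \<Longrightarrow> derived_algebra S \<subseteq> derived_algebra T"
  unfolding derived_algebra_def by (rule span_mono) blast

lemma derived_power_mono: "S \<subseteq> T \<Longrightarrow> (derived_algebra ^^ n) S \<subseteq> (derived_algebra ^^ n) T"
  by (induction n) (simp_all add: derived_algebra_mono)

lemma derived_power_zero: "(derived_algebra ^^ n) {0} = {0}"
  by (induction n) (simp_all add: derived_algebra_def)

lemma subspace_derived_power: "subspace S \<Longrightarrow> subspace ((derived_algebra ^^ n) S)"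
  by (cases n) (simp_all add: derived_algebra_def)

lemma ideal_sum:
  assumes I: "ideal I" and J: "ideal J"
  shows "ideal {x + y | x y. x \<in> I \<and> y \<in> J}"
  unfolding ideal_def
proof (intro conjI allI ballI)
  show "subspace {x + y | x y. x \<in> I \<and> y \<in> J}"
    using I J subspace_sums unfolding ideal_def by blast
  fix x y assume "y \<in> {x + y | x y. x \<in> I \<and> y \<in> J}"
  then show "\<lbrakk>x, y\<rbrakk> \<in> {x + y | x y. x \<in> I \<and> y \<in> J}"
    using I J unfolding ideal_def by (fastforce simp: bracket_add_right)
qed

lemma derived_power_sum:
  assumes I: "ideal I" and J: "ideal J"
  shows "(derived_algebra ^^ n) {x + y | x y. x \<in> I \<and> y \<in> J}
           \<subseteq> {x + y | x y. x \<in> (derived_algebra ^^ n) I \<and> y \<in> J}"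
proof (induction n)
  case (Suc n)
  let ?D = "(derived_algebra ^^ n) I"
  let ?D' = "(derived_algebra ^^ Suc n) I"
  have subJ: "subspace J" using J by (simp add: ideal_def)
  have subD': "subspace ?D'" by (simp add: derived_algebra_def)
  have "derived_algebra {x + y | x y. x \<in> ?D \<and> y \<in> J}
          \<subseteq> {x + y | x y. x \<in> ?D' \<and> y \<in> J}"
    unfolding derived_algebra_def[of "{x + y | x y. x \<in> ?D \<and> y \<in> J}"]
  proof (rule span_minimal)
    show "subspace {x + y | x y. x \<in> ?D' \<and> y \<in> J}"
      using subspace_sums[OF subD' subJ] .
    show "{\<lbrakk>u, v\<rbrakk> | u v. u \<in> {x + y | x y. x \<in> ?D \<and> y \<in> J} \<and> v \<in> {x + y | x y. x \<in> ?D \<and> y \<in> J}}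
            \<subseteq> {x + y | x y. x \<in> ?D' \<and> y \<in> J}"
    proof clarify
      fix a b c d assume a: "a \<in> ?D" and b: "b \<in> J" and c: "c \<in> ?D" and d: "d \<in> J"
      have "\<lbrakk>a, c\<rbrakk> \<in> ?D'"
        using a c by (auto simp: derived_algebra_def intro!: span_base)
      moreover have "\<lbrakk>a, d\<rbrakk> + \<lbrakk>b, c\<rbrakk> + \<lbrakk>b, d\<rbrakk> \<in> J"
        using J b d bracket_anti[of b c] subspace_diff[OF subJ] subspace_add[OF subJ]
        by (simp add: ideal_def)
      moreover have "\<lbrakk>a + b, c + d\<rbrakk> = \<lbrakk>a, c\<rbrakk> + (\<lbrakk>a, d\<rbrakk> + \<lbrakk>b, c\<rbrakk> + \<lbrakk>b, d\<rbrakk>)"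
        by (simp add: bracket_add_left bracket_add_right algebra_simps)
      ultimately show "\<exists>x y. \<lbrakk>a + b, c + d\<rbrakk> = x + y \<and> x \<in> ?D' \<and> y \<in> J"
        by blast
    qed
  qed
  with derived_algebra_mono[OF Suc.IH] show ?case by simp
qed auto

lemma solvable_sum:
  assumes I: "ideal I" "solvable I" and J: "ideal J" "solvable J"
  shows "solvable {x + y | x y. x \<in> I \<and> y \<in> J}"
proof -
  let ?S = "{x + y | x y. x \<in> I \<and> y \<in> J}"
  obtain m n where m: "(derived_algebra ^^ m) I = {0}" and n: "(derived_algebra ^^ n) J = {0}"
    using I J unfolding solvable_def by blast
  have "(derived_algebra ^^ m) ?S \<subseteq> J"
    using derived_power_sum[OF I(1) J(1), of m] m by auto
  then have "(derived_algebra ^^ (n + m)) ?S \<subseteq> {0}"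
    using derived_power_mono[of _ J n] n by (simp add: funpow_add)
  moreover have "0 \<in> (derived_algebra ^^ (n + m)) ?S"
    using ideal_sum[OF I(1) J(1)] by (simp add: subspace_0 subspace_derived_power ideal_def)
  ultimately have "(derived_algebra ^^ (n + m)) ?S = {0}" by blast
  then show ?thesis unfolding solvable_def by blast
qed

lemma solvable_radical:
  "ideal solvable_radical" "solvable solvable_radical"
  "ideal I \<Longrightarrow> solvable I \<Longrightarrow> I \<subseteq> solvable_radical"
proof -
  let ?P = "\<lambda>I. ideal I \<and> solvable I"
  have zero: "?P {0}"
    by (auto simp: ideal_def solvable_def intro: exI[of _ 0])
  obtain R where R: "?P R" and max: "\<And>I. ?P I \<Longrightarrow> dim I \<le> dim R"
    using ex_has_greatest_nat[of ?P "{0}" dim "Suc dimension"] zero dim_subset_UNIV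
    by (metis le_imp_less_Suc)
  have greatest: "I \<subseteq> R" if I: "?P I" for I
  proof -
    let ?S = "{x + y | x y. x \<in> R \<and> y \<in> I}"
    have S: "?P ?S" using R I ideal_sum solvable_sum by blast
    have sub: "subspace R" "subspace I" "subspace ?S"
      using R I S unfolding ideal_def by blast+
    have RS: "R \<subseteq> ?S" using subspace_0[OF sub(2)] by force
    have IS: "I \<subseteq> ?S" using subspace_0[OF sub(1)] by force
    have "R = ?S" using subspace_dim_equal[OF sub(1) sub(3) RS] max[OF S] by blast
    with IS show ?thesis by blast
  qed
  have "?P solvable_radical"
    unfolding solvable_radical_def using R greatest by (rule GreatestI2_order) auto
  moreover have "solvable_radical = R"
    unfolding solvable_radical_def using R greatest by (rule Greatest_equality)
  ultimately show "ideal solvable_radical" "solvable solvable_radical"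
    "ideal I \<Longrightarrow> solvable I \<Longrightarrow> I \<subseteq> solvable_radical"
    using greatest by auto
qed

end

end

theory Submission
  imports Defs
begin

text \<open>
  Suppose that the radical is nonzero. It contains a nonzero abelian restricted ideal \<open>B\<close>. A maximal
  restricted subalgebra \<open>M\<close> with \<open>B \<not>\<subseteq> M\<close> satisfies \<open>L = M + B\<close>, so \<open>M \<inter> B\<close> is an ideal; by dual
  atomisticity every restricted subalgebra of \<open>B\<close> is then an ideal of \<open>L\<close>. As the field is
  algebraically closed, \<open>B\<close> contains \<open>a \<noteq> 0\<close> whose \<open>p\<close>-th power is \<open>e a\<close> with \<open>e \<in> {0, 1}\<close>, so \<open>F a\<close>
  is an ideal. Let \<open>C\<close> be the centralizer of \<open>a\<close> and \<open>K\<close> the intersection of \<open>C\<close> with all maximal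
  restricted subalgebras \<open>N\<close> avoiding \<open>a\<close>. Since \<open>L = N + F a\<close> for each of them, \<open>K\<close> is a restricted
  ideal containing the second derived algebra of \<open>L\<close>.

  If \<open>y \<in> K\<close> is nonzero and has \<open>p\<close>-th power \<open>e y\<close>, then \<open>F (a + y)\<close> is a restricted subalgebra that does
  not contain \<open>a\<close>; some \<open>N\<close> contains it, hence also \<open>y\<close> and \<open>a\<close>, a contradiction. So \<open>K\<close> has
  either no nonzero toral element or no nonzero element with \<open>p\<close>-th power zero. In both cases all
  its elements are ad-nilpotent, and \<open>K\<close>, hence \<open>L\<close>, is solvable by Engel's theorem.
\<close>

section \<open>Linear dependence in sequences of vectors and eigenvectors of semilinear maps\<close>

context finite_dimensional_vector_space
begin

text \<open>Otherwise the first \<open>n\<close> vectors would span dimension \<open>n\<close> for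
  every \<open>n\<close>.\<close>

lemma ex_in_span_of_previous:
  fixes v :: "nat \<Rightarrow> 'b"
  shows "\<exists>n. v n \<in> span (v ` {..<n})"
proof (rule ccontr)
  assume "\<not> ?thesis"
  then have notin: "v n \<notin> span (v ` {..<n})" for n by blast
  have "dim (v ` {..<n}) = n" for n
    by (induction n) (simp_all add: lessThan_Suc dim_insert notin)
  from this[of "Suc dimension"] show False
    using dim_subset_UNIV[of "v ` {..<Suc dimension}"] by simp
qed

text \<open>Otherwise the dimension of the span of the tail would drop at every step,
  forever.\<close>

lemma ex_in_span_of_following:
  fixes v :: "nat \<Rightarrow> 'b"
  shows "\<exists>n. v n \<in> span (v ` {Suc n..})"
proof (rule ccontr)
  assume "\<not> ?thesis"
  then have notin: "v n \<notin> span (v ` {Suc n..})" for n by blast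
  have step: "v ` {n..} = insert (v n) (v ` {Suc n..})" for n
    by (force simp: image_iff Suc_le_eq le_less)
  have dim_step: "dim (v ` {n..}) = Suc (dim (v ` {Suc n..}))" for n
    by (subst step) (simp add: dim_insert notin)
  have "dim (v ` {0..}) = n + dim (v ` {n..})" for n
  proof (induction n)
    case (Suc n)
    then show ?case using dim_step[of n] by linarith
  qed simp
  from this[of "Suc dimension"] show False
    using dim_subset_UNIV[of "v ` {0..}"] by simp
qed

end

context vector_space
begin

lemma span_image_lessThan:
  assumes "w \<in> span (v ` {..<n})"
  shows "\<exists>c. w = (\<Sum>i<n::nat. c i *s v i)"
  using assms
proof (induction n arbitrary: w)
  case (Suc n)
  then obtain k where "w - k *s v n \<in> span (v ` {..<n})"
    by (auto simp: lessThan_Suc span_breakdown_eq)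
  from Suc.IH[OF this] obtain c where "w - k *s v n = (\<Sum>i<n. c i *s v i)" by blast
  then have "w = (\<Sum>i<Suc n. (c(n := k)) i *s v i)" by (simp add: diff_eq_eq)
  then show ?case by blast
qed simp

end

locale alg_closed_finite_dimensional_vector_space = finite_dimensional_vector_space scale Basis
  for scale :: "'f::alg_closed_field \<Rightarrow> 'l::ab_group_add \<Rightarrow> 'l" (infixr \<open>*s\<close> 75)
    and Basis :: "'l set"
begin

text \<open>If \<open>v\<^sub>0, \<dots>, v\<^sub>m\<close> are independent and \<open>v\<^bsub>m+1\<^esub> = \<Sum>\<^sub>i c\<^sub>i v\<^sub>i\<close>, then the equation \<open>z f(t) = t\<close> for
  \<open>t = \<Sum>\<^sub>i d\<^sub>i v\<^sub>i\<close> with \<open>d\<^sub>m = 1\<close> reads \<open>d\<^sub>0 = z c\<^sub>0\<close>, \<open>d\<^bsub>i+1\<^esub> = z (d\<^sub>i\<^sup>q + c\<^bsub>i+1\<^esub>)\<close>. Solving for the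
  \<open>d\<^sub>i\<close> as polynomials in \<open>z\<close> leaves the single polynomial equation \<open>d\<^sub>m(z) = 1\<close>.\<close>

lemma semilinear_eigenvector:
  fixes v :: "nat \<Rightarrow> 'l"
  assumes q: "q > 0"
    and f: "\<And>n d. f (\<Sum>i<n. d i *s v i) = (\<Sum>i<n. d i ^ q *s v (Suc i))"
    and nz: "\<And>n. v n \<noteq> 0"
  obtains z t where "z \<noteq> 0" "t \<noteq> 0" "t \<in> span (range v)" "f t = z *s t"
proof -
  define n where "n = (LEAST n. v n \<in> span (v ` {..<n}))"
  have vn: "v n \<in> span (v ` {..<n})"
    unfolding n_def using ex_in_span_of_previous by (rule LeastI_ex)
  have least: "v k \<notin> span (v ` {..<k})" if "k < n" for k
    using that unfolding n_def by (rule not_less_Least)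
  have "n \<noteq> 0" using vn nz[of 0] by (cases n) auto
  then obtain m where m: "n = Suc m" using not0_implies_Suc by blast
  obtain c where c: "v n = (\<Sum>i<n. c i *s v i)" using span_image_lessThan[OF vn] by blast
  \<comment> \<open>From index \<open>j\<close> on, this nonzero coefficient keeps the polynomials
    \<open>D i\<close> from vanishing.\<close>
  obtain j where j: "j \<le> m" "c j \<noteq> 0"
  proof (rule ccontr)
    assume "\<not> thesis"
    with that have "\<And>i. i < n \<Longrightarrow> c i = 0" using m by fastforce
    with c nz[of n] show False by simp
  qed
  define D where "D = rec_nat (monom (c 0) 1) (\<lambda>i P. monom 1 1 * (P ^ q + [:c (Suc i):]))"
  have D0: "D 0 = monom (c 0) 1" and DS: "\<And>i. D (Suc i) = monom 1 1 * (D i ^ q + [:c (Suc i):])"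
    by (simp_all add: D_def)
  \<comment> \<open>Hence a nonzero \<open>D i\<close> is nonconstant, so a constant added to
    \<open>D i ^ q\<close> cannot cancel it; the root of \<open>D m - 1\<close> will be nonzero for
    the same reason.\<close>
  have D_at_0: "poly (D i) 0 = 0" for i
    by (cases i) (simp_all add: D0 DS poly_monom)
  have D_nz: "D i \<noteq> 0" if "j \<le> i" for i
    using that
  proof (induction i rule: dec_induct)
    case base
    show ?case
    proof (cases j)
      case 0 then show ?thesis using j by (simp add: D0)
    next
      case (Suc k)
      have "poly (D k ^ q + [:c (Suc k):]) 0 \<noteq> 0" using q j Suc D_at_0[of k] by (simp add: zero_power)
      then have "D k ^ q + [:c (Suc k):] \<noteq> 0" by (metis poly_0)
      then show ?thesis unfolding Suc DS by simp
    qed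
  next
    case (step i)
    have "degree (D i) \<noteq> 0"
    proof
      assume "degree (D i) = 0"
      then obtain a where "D i = [:a:]" by (rule degree_eq_zeroE)
      with D_at_0[of i] step.IH show False by simp
    qed
    then have "degree (D i ^ q) > 0" using q step.IH by (simp add: degree_power_eq)
    then have "degree (D i ^ q + [:c (Suc i):]) > 0" by (simp add: degree_add_eq_left)
    then have "D i ^ q + [:c (Suc i):] \<noteq> 0" by force
    then show ?case unfolding DS by simp
  qed
  have "degree (D m - 1) > 0"
  proof (rule ccontr)
    assume "\<not> ?thesis"
    then obtain a where a: "D m - 1 = [:a:]" using degree_eq_zeroE by blast
    then have "D m = [:a + 1:]" by (simp add: diff_eq_eq one_pCons)
    with D_at_0[of m] D_nz[OF j(1)] show False by simp
  qed
  then obtain z where "poly (D m - 1) z = 0" using alg_closed_imp_poly_has_root by blast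
  then have z: "poly (D m) z = 1" by simp
  then have z0: "z \<noteq> 0" using D_at_0[of m] by auto
  define d where "d i = poly (D i) z" for i
  have d0: "d 0 = z * c 0" and dS: "\<And>i. d (Suc i) = z * (d i ^ q + c (Suc i))" and dm: "d m = 1"
    using z by (simp_all add: d_def D0 DS poly_monom)
  define t where "t = (\<Sum>i<n. d i *s v i)"
  have "z *s f t = z *s ((\<Sum>i<m. d i ^ q *s v (Suc i)) + v n)"
    unfolding t_def f by (simp add: m dm)
  also have "\<dots> = z *s (c 0 *s v 0 + (\<Sum>i<m. (d i ^ q + c (Suc i)) *s v (Suc i)))"
    unfolding m c[unfolded m] sum.lessThan_Suc_shift
    by (simp add: scale_left_distrib sum.distrib algebra_simps)
  also have "\<dots> = d 0 *s v 0 + (\<Sum>i<m. d (Suc i) *s v (Suc i))"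
    by (simp add: d0 dS scale_right_distrib scale_sum_right)
  also have "\<dots> = t"
    unfolding t_def m sum.lessThan_Suc_shift ..
  finally have zt: "z *s f t = t" .
  have "t \<noteq> 0"
  proof
    assume "t = 0"
    then have "v m = - (\<Sum>i<m. d i *s v i)"
      by (simp add: t_def m dm add.commute eq_neg_iff_add_eq_0)
    also have "\<dots> \<in> span (v ` {..<m})"
      by (intro span_neg span_sum span_scale span_base) simp
    finally show False using least[of m] m by simp
  qed
  moreover have "t \<in> span (range v)"
    unfolding t_def by (intro span_sum span_scale span_base) simp
  moreover have "f t = inverse z *s t"
    using z0 by (subst zt[symmetric]) simp
  ultimately show thesis using that[of "inverse z" t] z0 by simp
qed

end

section \<open>Bracket identities and Engel's theorem\<close>

context finite_dimensional_lie_algebra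
begin

lemma bracket_minus_right: "\<lbrakk>x, - y\<rbrakk> = - \<lbrakk>x, y\<rbrakk>"
  using bracket_add_right[of x y "- y"] by (simp add: eq_neg_iff_add_eq_0 add.commute)

lemma bracket_sum_right: "\<lbrakk>x, sum g I\<rbrakk> = (\<Sum>i\<in>I. \<lbrakk>x, g i\<rbrakk>)"
  by (induction I rule: infinite_finite_induct) (simp_all add: bracket_add_right)

lemma bracket_commute_zero: "\<lbrakk>x, y\<rbrakk> = 0 \<longleftrightarrow> \<lbrakk>y, x\<rbrakk> = 0"
  using bracket_anti[of x y] by simp

lemma leibniz: "\<lbrakk>x, \<lbrakk>y, z\<rbrakk>\<rbrakk> = \<lbrakk>\<lbrakk>x, y\<rbrakk>, z\<rbrakk> + \<lbrakk>y, \<lbrakk>x, z\<rbrakk>\<rbrakk>"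
proof -
  have "\<lbrakk>x, \<lbrakk>y, z\<rbrakk>\<rbrakk> = - \<lbrakk>z, \<lbrakk>x, y\<rbrakk>\<rbrakk> - \<lbrakk>y, \<lbrakk>z, x\<rbrakk>\<rbrakk>"
    using jacobi[of x y z] by (simp add: algebra_simps eq_neg_iff_add_eq_0)
  also have "- \<lbrakk>z, \<lbrakk>x, y\<rbrakk>\<rbrakk> = \<lbrakk>\<lbrakk>x, y\<rbrakk>, z\<rbrakk>" using bracket_anti[of z] by simp
  also have "\<lbrakk>y, \<lbrakk>z, x\<rbrakk>\<rbrakk> = - \<lbrakk>y, \<lbrakk>x, z\<rbrakk>\<rbrakk>"
    using bracket_anti[of z x] by (simp add: bracket_minus_right)
  finally show ?thesis by simp
qed

lemma ideal_bracket_left: "ideal I \<Longrightarrow> x \<in> I \<Longrightarrow> \<lbrakk>x, y\<rbrakk> \<in> I"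
  using bracket_anti[of x y] subspace_neg[of I] by (simp add: ideal_def)

lemma solvable_derived:
  assumes "derived_algebra S \<subseteq> T" "solvable T"
  shows "solvable S"
proof -
  obtain n where n: "(derived_algebra ^^ n) T = {0}" using assms(2) by (auto simp: solvable_def)
  have "(derived_algebra ^^ Suc n) S \<subseteq> {0}"
    using derived_power_mono[OF assms(1), of n] n by (simp add: funpow_swap1)
  moreover have "0 \<in> (derived_algebra ^^ Suc n) S" by (simp add: derived_algebra_def span_zero)
  ultimately show ?thesis unfolding solvable_def by blast
qed

definition ad_nilpotent :: "'l \<Rightarrow> bool" where
  "ad_nilpotent x \<longleftrightarrow> (\<forall>y. \<exists>n. (bracket x ^^ n) y = 0)"

text \<open>A proper subalgebra \<open>K\<close> of maximal dimension is normalized by some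
  \<open>v\<close> outside it, so \<open>K + F v\<close> is a subalgebra and equals
  \<open>H\<close>. The assumption \<open>normalizer\<close> is supplied by
  \<open>engel_vector\<close> or by its induction hypothesis.\<close>

lemma engel_ideal:
  assumes H: "subalgebra H" "H \<noteq> {0}"
    and normalizer: "\<And>K. subalgebra K \<Longrightarrow> K \<subset> H \<Longrightarrow> \<exists>v\<in>H - K. \<forall>k\<in>K. \<lbrakk>k, v\<rbrakk> \<in> K"
  obtains K v where "subalgebra K" "K \<subset> H" "H = span (insert v K)" "v \<in> H" "\<forall>k\<in>K. \<lbrakk>k, v\<rbrakk> \<in> K"
    "derived_algebra H \<subseteq> K"
proof -
  let ?P = "\<lambda>K. subalgebra K \<and> K \<subset> H"
  have subH: "subspace H" using H by (simp add: subalgebra_def)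
  have "?P {0}" using H subspace_0[OF subH] by (auto simp: subalgebra_def)
  moreover have "dim K < Suc dimension" for K by (simp add: dim_subset_UNIV less_Suc_eq_le)
  ultimately obtain K where K: "?P K" and max: "\<And>K'. ?P K' \<Longrightarrow> dim K' \<le> dim K"
    using ex_has_greatest_nat[of ?P "{0}" dim "Suc dimension"] by (metis le_imp_less_Suc nat_less_le)
  obtain v where v: "v \<in> H" "v \<notin> K" "\<forall>k\<in>K. \<lbrakk>k, v\<rbrakk> \<in> K"
    using normalizer K by blast
  have subK: "subspace K" using K by (simp add: subalgebra_def)
  then have spanK: "span K = K" by simp
  let ?S = "span (insert v K)"
  \<comment> \<open>Modulo \<open>K\<close> both arguments are multiples of \<open>v\<close>, and
    \<open>v\<close> commutes with itself.\<close>
  have br: "\<lbrakk>x, y\<rbrakk> \<in> K" if xy: "x \<in> ?S" "y \<in> ?S" for x y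
  proof -
    obtain a b where a: "x - a *s v \<in> K" and b: "y - b *s v \<in> K"
      using xy by (auto simp: span_breakdown_eq spanK)
    define k l where kl: "k = x - a *s v" "l = y - b *s v"
    have "\<lbrakk>x, y\<rbrakk> = \<lbrakk>k + a *s v, l + b *s v\<rbrakk>" by (simp add: kl)
    also have "\<dots> = \<lbrakk>k, l\<rbrakk> + b *s \<lbrakk>k, v\<rbrakk> - a *s \<lbrakk>l, v\<rbrakk>"
      using bracket_anti[of v l]
      by (simp add: bracket_add_left bracket_add_right bracket_scale_left bracket_scale_right bracket_self)
    also have "\<dots> \<in> K"
      using a b v(3) K unfolding kl[symmetric] subalgebra_def
      by (intro subspace_diff subspace_add subspace_scale) auto
    finally show ?thesis .
  qed
  have KS: "K \<subseteq> ?S" using span_superset by blast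
  have S: "subalgebra ?S" unfolding subalgebra_def using br KS by blast
  have SH: "?S \<subseteq> H" using v K subH by (intro span_minimal) auto
  have "?S = H"
  proof (rule ccontr)
    assume "?S \<noteq> H"
    then have "dim ?S \<le> dim K" using max S SH by blast
    then have "K = ?S" using subspace_dim_equal[OF subK subspace_span KS] by blast
    then show False using v(2) span_base[of v "insert v K"] by blast
  qed
  moreover have "derived_algebra ?S \<subseteq> K"
    unfolding derived_algebra_def using br subK by (intro span_minimal) auto
  ultimately show thesis using that K v by metis
qed

text \<open>Engel's theorem for the action of \<open>H\<close> on \<open>V / W\<close>, without
  quotients. With \<open>V = H\<close> and \<open>W = K\<close> it yields the vector normalizing
  \<open>K\<close> that \<open>engel_ideal\<close> asks for.\<close>

lemma engel_vector:
  assumes "subalgebra H" "\<forall>h\<in>H. ad_nilpotent h"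
    and "subspace V" "subspace W" "W \<subset> V"
    and "\<forall>h\<in>H. \<forall>v\<in>V. \<lbrakk>h, v\<rbrakk> \<in> V" "\<forall>h\<in>H. \<forall>w\<in>W. \<lbrakk>h, w\<rbrakk> \<in> W"
  shows "\<exists>v\<in>V - W. \<forall>h\<in>H. \<lbrakk>h, v\<rbrakk> \<in> W"
  using assms
proof (induction "dim H" arbitrary: H V W rule: less_induct)
  case less
  note H = less.prems(1,2) and VW = less.prems(3-5) and inv = less.prems(6,7)
  show ?case
  proof (cases "H = {0}")
    case True
    then show ?thesis using VW subspace_0[of W] by auto
  next
    case False
    have dimK: "dim K < dim H" if "subalgebra K" "K \<subset> H" for K
      using that H by (intro dim_psubset) (simp add: subalgebra_def psubset_eq span_eq_iff[THEN iffD2])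
    obtain K u where K: "subalgebra K" "K \<subset> H" "H = span (insert u K)" "u \<in> H" "\<forall>k\<in>K. \<lbrakk>k, u\<rbrakk> \<in> K"
    proof (rule engel_ideal[OF H(1) False])
      fix K assume K: "subalgebra K" "K \<subset> H"
      show "\<exists>v\<in>H - K. \<forall>k\<in>K. \<lbrakk>k, v\<rbrakk> \<in> K"
        using K H by (intro less.hyps[OF dimK]) (auto simp: subalgebra_def)
    qed blast
    have "\<exists>v\<in>V - W. \<forall>k\<in>K. \<lbrakk>k, v\<rbrakk> \<in> W"
      using K(1,2) H VW inv by (intro less.hyps[OF dimK]) auto
    then obtain v where v: "v \<in> V" "v \<notin> W" "\<forall>k\<in>K. \<lbrakk>k, v\<rbrakk> \<in> W" by blast
    \<comment> \<open>As \<open>u\<close> normalizes \<open>K\<close>, applying \<open>ad u\<close>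
      to a vector killed by \<open>K\<close> modulo \<open>W\<close> gives another one. The iterate
      just before the first in \<open>W\<close> is killed modulo \<open>W\<close> by
      \<open>u\<close> too, hence by \<open>H = K + F u\<close>.\<close>
    define y where "y n = (bracket u ^^ n) v" for n
    have y: "y n \<in> V \<and> (\<forall>k\<in>K. \<lbrakk>k, y n\<rbrakk> \<in> W)" for n
    proof (induction n)
      case (Suc n)
      have "\<lbrakk>k, \<lbrakk>u, y n\<rbrakk>\<rbrakk> \<in> W" if k: "k \<in> K" for k
        unfolding leibniz[of k u] using Suc K(4,5) k inv VW by (intro subspace_add) auto
      then show ?case using Suc K(4) inv by (simp add: y_def)
    qed (simp add: y_def v)
    obtain N where "y N = 0" using H K(4) by (auto simp: ad_nilpotent_def y_def)
    then have ex: "\<exists>n. y n \<in> W" using VW subspace_0 by metis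
    define n where "n = (LEAST n. y n \<in> W)"
    have n: "y n \<in> W" unfolding n_def using ex by (rule LeastI_ex)
    have "n \<noteq> 0" using n v by (cases n) (auto simp: y_def)
    then obtain m where m: "n = Suc m" using not0_implies_Suc by blast
    have ym: "y m \<notin> W" using not_less_Least[of m "\<lambda>n. y n \<in> W"] m n_def by simp
    have "\<lbrakk>h, y m\<rbrakk> \<in> W" if h: "h \<in> H" for h
    proof -
      obtain a where a: "h - a *s u \<in> K"
        using h K(1,3) by (auto simp: span_breakdown_eq subalgebra_def span_eq_iff[THEN iffD2])
      have "\<lbrakk>h, y m\<rbrakk> = \<lbrakk>h - a *s u, y m\<rbrakk> + a *s y n"
        by (simp add: m y_def flip: bracket_scale_left bracket_add_left)
      also have "\<dots> \<in> W" using a y[of m] n VW by (intro subspace_add subspace_scale) auto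
      finally show ?thesis .
    qed
    then show ?thesis using y ym by blast
  qed
qed

text \<open>Induction on \<open>dim H\<close>: \<open>engel_ideal\<close> puts
  \<open>derived_algebra H\<close> into a proper subalgebra.\<close>

theorem engel_solvable:
  assumes "subalgebra H" "\<forall>h\<in>H. ad_nilpotent h"
  shows "solvable H"
  using assms
proof (induction "dim H" arbitrary: H rule: less_induct)
  case (less H)
  show ?case
  proof (cases "H = {0}")
    case True
    then show ?thesis by (auto simp: solvable_def intro: exI[of _ 0])
  next
    case False
    obtain K where K: "subalgebra K" "K \<subset> H" "derived_algebra H \<subseteq> K"
    proof (rule engel_ideal[OF less.prems(1) False])
      fix K assume K: "subalgebra K" "K \<subset> H"
      then show "\<exists>v\<in>H - K. \<forall>k\<in>K. \<lbrakk>k, v\<rbrakk> \<in> K"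
        using less.prems by (intro engel_vector) (auto simp: subalgebra_def)
    qed blast
    have "dim K < dim H" 
      using K less.prems by (intro dim_psubset) (simp add: subalgebra_def psubset_eq span_eq_iff[THEN iffD2])
    then show ?thesis using K less by (intro solvable_derived[OF K(3)]) auto
  qed
qed

section \<open>Centralizers, ideals and the derived series\<close>

definition centralizer :: "'l set \<Rightarrow> 'l set" where
  "centralizer S = {x. \<forall>y\<in>S. \<lbrakk>x, y\<rbrakk> = 0}"

lemma subspace_centralizer: "subspace (centralizer S)"
  by (auto simp: subspace_def centralizer_def bracket_add_left bracket_scale_left)

lemma ideal_centralizer:
  assumes "ideal I"
  shows "ideal (centralizer I)"
  unfolding ideal_def
proof (intro conjI allI ballI subspace_centralizer)
  fix x y assume y: "y \<in> centralizer I"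
  have "\<lbrakk>\<lbrakk>x, y\<rbrakk>, z\<rbrakk> = 0" if "z \<in> I" for z
    using leibniz[of x y z] y that assms by (simp add: centralizer_def ideal_def)
  then show "\<lbrakk>x, y\<rbrakk> \<in> centralizer I" by (simp add: centralizer_def)
qed

lemma ideal_Inter: "\<forall>I\<in>\<I>. ideal I \<Longrightarrow> ideal (\<Inter>\<I>)"
  by (simp add: ideal_def subspace_Inter)

lemma ideal_Int: "ideal I \<Longrightarrow> ideal J \<Longrightarrow> ideal (I \<inter> J)"
  by (simp add: ideal_def subspace_inter)

lemma ideal_derived:
  assumes "ideal I"
  shows "ideal (derived_algebra I)"
  unfolding ideal_def
proof (intro conjI allI ballI)
  show "subspace (derived_algebra I)" by (simp add: derived_algebra_def)
  fix x y assume "y \<in> derived_algebra I"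
  then show "\<lbrakk>x, y\<rbrakk> \<in> derived_algebra I"
    unfolding derived_algebra_def
  proof (induction rule: span_induct_alt)
    case (step c b z)
    then obtain u v where uv: "b = \<lbrakk>u, v\<rbrakk>" "u \<in> I" "v \<in> I" by blast
    have "\<lbrakk>x, b\<rbrakk> \<in> span {\<lbrakk>x, y\<rbrakk> |x y. x \<in> I \<and> y \<in> I}"
      unfolding uv(1) leibniz[of x u v] using uv assms
      by (intro span_add) (auto intro!: span_base simp: ideal_def)
    then show ?case
      using step.IH by (auto simp: bracket_add_right bracket_scale_right intro!: span_add span_scale)
  qed (simp add: span_zero)
qed

text \<open>The last nonzero term of the derived series of \<open>I\<close> is such an
  ideal.\<close>

lemma solvable_ideal_abelian_ideal:
  assumes "ideal I" "solvable I" "I \<noteq> {0}"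
  obtains J where "ideal J" "J \<noteq> {0}" "J \<subseteq> centralizer J"
proof -
  define n where "n = (LEAST n. (derived_algebra ^^ n) I = {0})"
  have n: "(derived_algebra ^^ n) I = {0}"
    using assms(2) unfolding solvable_def n_def by (rule LeastI_ex)
  then have "n \<noteq> 0" using assms(3) by (metis funpow_0)
  then obtain m where m: "n = Suc m" using not0_implies_Suc by blast
  define J where "J = (derived_algebra ^^ m) I"
  have "ideal ((derived_algebra ^^ k) I)" for k
    by (induction k) (simp_all add: assms(1) ideal_derived)
  then have "ideal J" by (simp add: J_def)
  moreover have "J \<noteq> {0}"
    unfolding J_def using not_less_Least[of m "\<lambda>n. (derived_algebra ^^ n) I = {0}"] m n_def by simp
  moreover have "\<lbrakk>x, y\<rbrakk> = 0" if "x \<in> J" "y \<in> J" for x y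
  proof -
    have "\<lbrakk>x, y\<rbrakk> \<in> derived_algebra J"
      unfolding derived_algebra_def using that by (intro span_base) blast
    then show ?thesis using n m by (simp add: J_def)
  qed
  ultimately show thesis using that unfolding centralizer_def by blast
qed

lemma funpow_bracket_zero [simp]: "(bracket x ^^ n) 0 = 0"
  by (induction n) simp_all

lemma span_commutes:
  assumes "S \<subseteq> centralizer S"
  shows "span S \<subseteq> centralizer (span S)"
proof -
  have "span S \<subseteq> centralizer S" using assms subspace_centralizer by (rule span_minimal)
  then have "S \<subseteq> centralizer (span S)"
    using bracket_commute_zero unfolding centralizer_def by blast
  then show ?thesis using subspace_centralizer by (rule span_minimal)
qed

end

section \<open>The \<open>p\<close>-map, Jacobson's terms and commuting elements\<close>

locale alg_closed_restricted_lie_algebra =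
  restricted_lie_algebra scale bracket pmap + finite_dimensional_lie_algebra scale bracket Basis
  for scale :: "'f::alg_closed_field \<Rightarrow> 'l::ab_group_add \<Rightarrow> 'l" (infixr \<open>*s\<close> 75)
    and bracket :: "'l \<Rightarrow> 'l \<Rightarrow> 'l"  (\<open>\<lbrakk>_,/ _\<rbrakk>\<close>)
    and pmap :: "'l \<Rightarrow> 'l"
    and Basis :: "'l set"
begin

sublocale alg_closed_finite_dimensional_vector_space scale Basis ..

lemma CHAR_ge_2: "CHAR('f) \<ge> 2"
  using char_pos prime_CHAR_semidom[where 'a='f] prime_ge_2_nat by blast

lemma coeff_ad_pencil:
  "coeff (ad_pencil x y q) j = (case j of 0 \<Rightarrow> 0 | Suc i \<Rightarrow> \<lbrakk>x, coeff q i\<rbrakk>) + \<lbrakk>y, coeff q j\<rbrakk>"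
  by (simp add: ad_pencil_def coeff_pCons coeff_map_poly split: nat.split)

text \<open>The first \<open>ad_pencil x y\<close> turns \<open>x\<close> into
  \<open>\<lbrakk>y, x\<rbrakk>\<close>, and further ones stay in \<open>J\<close>; as
  \<open>p \<ge> 2\<close>, there is at least one. For \<open>J = {0}\<close> this makes the
  \<open>p\<close>-map additive on commuting elements; for an ideal \<open>J\<close> it controls the
  \<open>p\<close>-map on \<open>M + J\<close>.\<close>

lemma jacobson_term_mem:
  assumes J: "subspace J" "\<And>z. z \<in> J \<Longrightarrow> \<lbrakk>x, z\<rbrakk> \<in> J" "\<And>z. z \<in> J \<Longrightarrow> \<lbrakk>y, z\<rbrakk> \<in> J" "\<lbrakk>y, x\<rbrakk> \<in> J"
  shows "jacobson_term i x y \<in> J"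
proof -
  have J0: "0 \<in> J" using J(1) by (rule subspace_0)
  have "coeff ((ad_pencil x y ^^ Suc k) [:x:]) j \<in> J" for k j
  proof (induction k arbitrary: j)
    case 0
    show ?case using J0 J(4)
      by (auto simp: coeff_ad_pencil coeff_pCons bracket_self split: nat.split)
  next
    case (Suc k)
    show ?case
      unfolding funpow.simps(2)[of "Suc k"] o_apply coeff_ad_pencil
      using Suc J J0 by (intro subspace_add) (auto split: nat.split)
  qed
  moreover have "CHAR('f) - 1 = Suc (CHAR('f) - 2)" using CHAR_ge_2 by simp
  ultimately show ?thesis
    unfolding jacobson_term_def using J(1) by (simp only: subspace_scale)
qed

lemma pmap_0 [simp]: "pmap 0 = 0"
  using pmap_scale[of 0 0] char_pos by (simp add: zero_power)

lemma pmap_add_commute: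
  assumes "\<lbrakk>x, y\<rbrakk> = 0"
  shows "pmap (x + y) = pmap x + pmap y"
proof -
  have "jacobson_term i x y \<in> {0}" for i
    using assms bracket_commute_zero[of x y] by (intro jacobson_term_mem) auto
  then show ?thesis by (simp add: pmap_add)
qed

lemma pmap_sum_commute:
  assumes "\<And>i j. \<lbrakk>w i, w j\<rbrakk> = 0"
  shows "pmap (\<Sum>i<n::nat. d i *s w i) = (\<Sum>i<n. d i ^ CHAR('f) *s pmap (w i))"
proof (induction n)
  case (Suc n)
  have "\<lbrakk>d n *s w n, \<Sum>i<n. d i *s w i\<rbrakk> = 0"
    by (simp add: bracket_sum_right bracket_scale_left bracket_scale_right assms)
  then have "\<lbrakk>\<Sum>i<n. d i *s w i, d n *s w n\<rbrakk> = 0" using bracket_commute_zero by blast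
  then show ?case using Suc by (simp add: pmap_add_commute pmap_scale)
qed simp

lemma bracket_pmap_zero:
  assumes "\<lbrakk>x, y\<rbrakk> = 0"
  shows "\<lbrakk>pmap x, y\<rbrakk> = 0"
proof -
  obtain k where "CHAR('f) = Suc k" using char_pos gr0_implies_Suc by blast
  then show ?thesis using assms by (simp add: ad_pmap funpow_Suc_right del: funpow.simps)
qed

lemma pmap_funpow_commute: "\<lbrakk>(pmap ^^ i) x, (pmap ^^ j) x\<rbrakk> = 0"
proof -
  have *: "\<lbrakk>(pmap ^^ i) x, y\<rbrakk> = 0" if "\<lbrakk>x, y\<rbrakk> = 0" for i x y
    using that by (induction i) (simp_all add: bracket_pmap_zero)
  have "\<lbrakk>x, (pmap ^^ j) x\<rbrakk> = 0"
    using *[OF bracket_self] bracket_commute_zero by blast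
  then show ?thesis by (rule *)
qed

section \<open>Toral elements and criteria for ad-nilpotency\<close>

lemma bracket_pmap_funpow: "bracket ((pmap ^^ n) x) = bracket x ^^ (CHAR('f) ^ n)"
proof (induction n)
  case (Suc n)
  have "bracket (pmap z) = bracket z ^^ CHAR('f)" for z by (rule ext) (rule ad_pmap)
  then show ?case using Suc by (simp add: funpow_mult mult.commute)
qed simp

lemma ad_nilpotent_if_pmap_nilpotent:
  assumes "(pmap ^^ n) x = 0"
  shows "ad_nilpotent x"
  unfolding ad_nilpotent_def
proof
  fix y
  show "\<exists>n. (bracket x ^^ n) y = 0"
    using bracket_pmap_funpow[of n x] assms by (metis bracket_zero_left)
qed

lemma pmap_funpow_mem: "restricted_subalgebra S \<Longrightarrow> x \<in> S \<Longrightarrow> (pmap ^^ n) x \<in> S"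
  by (induction n) (simp_all add: restricted_subalgebra_def)

lemma restricted_subalgebra_subspace: "restricted_subalgebra S \<Longrightarrow> subspace S"
  by (simp add: restricted_subalgebra_def subalgebra_def)

text \<open>The iterates of the \<open>p\<close>-map on \<open>x\<close> commute, so it is
  \<open>p\<close>-semilinear on their span and has an eigenvector there with nonzero
  eigenvalue.\<close>

lemma ex_toral_if_not_pmap_nilpotent:
  assumes S: "restricted_subalgebra S" "x \<in> S" and nz: "\<And>n. (pmap ^^ n) x \<noteq> 0"
  obtains t where "t \<in> S" "t \<noteq> 0" "pmap t = t"
proof -
  let ?v = "\<lambda>n. (pmap ^^ n) x"
  obtain z t where z: "z \<noteq> 0" and t: "t \<noteq> 0" "t \<in> span (range ?v)" "pmap t = z *s t"
  proof (rule semilinear_eigenvector[where f = pmap and v = ?v and q = "CHAR('f)"])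
    show "pmap (\<Sum>i<n. d i *s ?v i) = (\<Sum>i<n. d i ^ CHAR('f) *s ?v (Suc i))" for n d
      by (simp add: pmap_sum_commute pmap_funpow_commute)
  qed (use char_pos nz in auto)
  have "CHAR('f) - 1 > 0" using CHAR_ge_2 by simp
  \<comment> \<open>Scaling \<open>t\<close> by this \<open>u\<close> changes the eigenvalue
    \<open>z\<close> to \<open>u ^ (p - 1) * z = 1\<close>.\<close>
  then obtain u where u: "u ^ (CHAR('f) - 1) = inverse z" using nth_root_exists by blast
  have "u ^ CHAR('f) = u * inverse z"
    using u char_pos by (metis power_eq_if not_gr0)
  then have "pmap (u *s t) = u *s t" using z t(3) by (simp add: pmap_scale)
  moreover have "u \<noteq> 0" using u z \<open>CHAR('f) - 1 > 0\<close> by (auto simp: zero_power)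
  moreover have "t \<in> S"
    using t(2) span_minimal[of "range ?v" S] S restricted_subalgebra_subspace pmap_funpow_mem
    by blast
  ultimately show thesis
    using that[of "u *s t"] t S restricted_subalgebra_subspace subspace_scale by auto
qed

text \<open>Since the field is perfect, the \<open>p\<close>-map sends subspaces of commuting elements to subspaces.\<close>

lemma mem_span_pmap_powers:
  assumes K: "restricted_subalgebra K" "\<And>z. z \<in> K \<Longrightarrow> pmap z = 0 \<Longrightarrow> z = 0" and y: "y \<in> K"
  shows "y \<in> span ((\<lambda>i. (pmap ^^ i) y) ` {1..})"
proof -
  define P where "P i = (pmap ^^ i) y" for i
  define S where "S r = span (P ` {r..})" for r
  have subS: "subspace (S r)" for r by (simp add: S_def)
  have P_Suc: "pmap (P i) = P (Suc i)" for i by (simp add: P_def)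
  have "span (range P) \<subseteq> centralizer (span (range P))"
    by (rule span_commutes) (auto simp: centralizer_def P_def pmap_funpow_commute)
  then have comm: "\<lbrakk>u, v\<rbrakk> = 0" if "u \<in> span (range P)" "v \<in> span (range P)" for u v
    using that by (auto simp: centralizer_def)
  have SP: "S r \<subseteq> span (range P)" for r unfolding S_def by (intro span_mono) blast
  have SK: "S r \<subseteq> K" for r
    unfolding S_def using K y restricted_subalgebra_subspace pmap_funpow_mem
    by (intro span_minimal) (auto simp: P_def)
  have shift: "S (Suc r) \<subseteq> pmap ` S r" for r
  proof -
    have "P ` {Suc r..} \<subseteq> pmap ` S r"
    proof clarify
      fix i assume "i \<ge> Suc r"
      then obtain k where "i = Suc k" "k \<ge> r" using Suc_le_D by auto
      then show "P i \<in> pmap ` S r" unfolding S_def using P_Suc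
        by (metis atLeast_iff imageI span_base)
    qed
    moreover have "subspace (pmap ` S r)"
    proof (rule subspaceI)
      show "0 \<in> pmap ` S r" using subspace_0[OF subS] pmap_0 by (metis imageI)
      show "u + v \<in> pmap ` S r" if uv: "u \<in> pmap ` S r" "v \<in> pmap ` S r" for u v
      proof -
        obtain a b where ab: "u = pmap a" "v = pmap b" "a \<in> S r" "b \<in> S r" using uv by blast
        then have "u + v = pmap (a + b)" using comm SP by (simp add: pmap_add_commute subset_iff)
        then show ?thesis using ab subspace_add[OF subS] by blast
      qed
      show "c *s u \<in> pmap ` S r" if u: "u \<in> pmap ` S r" for c u
      proof -
        obtain a where a: "u = pmap a" "a \<in> S r" using u by blast
        obtain b where "b ^ CHAR('f) = c" using nth_root_exists[OF char_pos] by blast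
        then have "c *s u = pmap (b *s a)" using a by (simp add: pmap_scale)
        then show ?thesis using a subspace_scale[OF subS] by blast
      qed
    qed
    ultimately show ?thesis unfolding S_def[of "Suc r"] by (rule span_minimal)
  qed
  have "\<exists>n. P n \<in> S (Suc n)" unfolding S_def by (rule ex_in_span_of_following)
  then obtain n where n: "P n \<in> S (Suc n)" and least: "\<And>m. m < n \<Longrightarrow> P m \<notin> S (Suc m)"
    using exists_least_iff[of "\<lambda>n. P n \<in> S (Suc n)"] by blast
  \<comment> \<open>Descent: if \<open>n = Suc m\<close>, then \<open>P n = pmap s\<close> with
    \<open>s \<in> S n\<close>, and additivity gives \<open>pmap (P m - s) = 0\<close>. So
    \<open>P m = s\<close> lies in \<open>S (Suc m)\<close>, against the minimality of
    \<open>n\<close>.\<close>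
  have "n = 0"
  proof (cases n)
    case (Suc m)
    then obtain s where s: "s \<in> S n" "P n = pmap s" using n shift by blast
    have Pm: "P m \<in> span (range P)" by (intro span_base) simp
    have "\<lbrakk>P m - s, s\<rbrakk> = 0"
      using s SP Pm by (intro comm span_diff) auto
    then have "pmap (P m) = pmap (P m - s) + pmap s"
      using pmap_add_commute[of "P m - s" s] by simp
    then have "pmap (P m - s) = 0" using s Suc by (simp add: P_Suc)
    moreover have "P m - s \<in> K"
      using s SK K(1) y
      by (intro subspace_diff restricted_subalgebra_subspace) (auto simp: P_def pmap_funpow_mem)
    ultimately have "P m = s" using K(2) by fastforce
    then show ?thesis using s least[of m] Suc by simp
  qed
  then show ?thesis using n by (simp add: S_def P_def[abs_def])
qed

text \<open>A non-nilpotent \<open>ad x\<close> has an eigenvector \<open>y\<close> with nonzero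
  eigenvalue, and \<open>y\<close> lies in the ideal \<open>K\<close>. The iterated
  \<open>p\<close>-th powers of \<open>y\<close> commute with \<open>x\<close>, and their span
  contains \<open>y\<close>, so \<open>y\<close> commutes with \<open>x\<close>, a
  contradiction.\<close>

lemma ad_nilpotent_if_no_pmap_kernel:
  assumes K: "ideal K" "restricted_subalgebra K" "\<And>z. z \<in> K \<Longrightarrow> pmap z = 0 \<Longrightarrow> z = 0" and x: "x \<in> K"
  shows "ad_nilpotent x"
proof (rule ccontr)
  assume "\<not> ?thesis"
  then obtain w where w: "\<And>n. (bracket x ^^ n) w \<noteq> 0" unfolding ad_nilpotent_def by blast
  let ?v = "\<lambda>n. (bracket x ^^ n) w"
  obtain l y where ly: "l \<noteq> 0" "y \<noteq> 0" "\<lbrakk>x, y\<rbrakk> = l *s y"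
  proof (rule semilinear_eigenvector[where f = "bracket x" and v = ?v and q = 1])
    show "\<lbrakk>x, \<Sum>i<n. d i *s ?v i\<rbrakk> = (\<Sum>i<n. d i ^ 1 *s ?v (Suc i))" for n d
      by (simp add: bracket_sum_right bracket_scale_right)
  qed (use w in auto)
  have "y = inverse l *s \<lbrakk>x, y\<rbrakk>" using ly by simp
  then have "y \<in> K"
    using ideal_bracket_left[OF K(1) x] subspace_scale K(1) unfolding ideal_def by metis
  \<comment> \<open>Two applications of \<open>ad y\<close> already kill \<open>x\<close>, and
    \<open>p \<ge> 2\<close>.\<close>
  have "\<lbrakk>(pmap ^^ Suc i) y, x\<rbrakk> = 0" for i
  proof (induction i)
    case 0
    obtain k where "CHAR('f) = Suc (Suc k)"
      using CHAR_ge_2 by (metis Suc_le_D numeral_2_eq_2 Suc_le_mono)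
    moreover have "\<lbrakk>y, \<lbrakk>y, x\<rbrakk>\<rbrakk> = 0"
      using bracket_anti[of y x] ly(3) by (simp add: bracket_minus_right bracket_scale_right bracket_self)
    ultimately show ?case by (simp add: ad_pmap funpow_Suc_right del: funpow.simps)
  qed (simp add: bracket_pmap_zero)
  then have "(\<lambda>i. (pmap ^^ i) y) ` {1..} \<subseteq> centralizer {x}"
    by (auto simp: centralizer_def Suc_le_eq dest!: gr0_implies_Suc)
  then have "y \<in> centralizer {x}"
    using mem_span_pmap_powers[OF K(2,3) \<open>y \<in> K\<close>] span_minimal subspace_centralizer by blast
  then show False using ly bracket_commute_zero by (auto simp: centralizer_def)
qed

section \<open>Maximal restricted subalgebras and ideals of dually atomistic algebras\<close>

lemma restricted_ideal_sum:
  assumes M: "restricted_subalgebra M" and I: "ideal I" "restricted_subalgebra I"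
  shows "restricted_subalgebra {x + y | x y. x \<in> M \<and> y \<in> I}" (is "restricted_subalgebra ?S")
  unfolding restricted_subalgebra_def subalgebra_def
proof (intro conjI ballI)
  have subI: "subspace I" using I by (simp add: ideal_def)
  show sub: "subspace ?S"
    using subspace_sums restricted_subalgebra_subspace M subI by blast
  show "\<lbrakk>u, v\<rbrakk> \<in> ?S" if uv: "u \<in> ?S" "v \<in> ?S" for u v
  proof -
    obtain a b c d where ab: "u = a + b" "a \<in> M" "b \<in> I" and cd: "v = c + d" "c \<in> M" "d \<in> I"
      using uv by blast
    have "\<lbrakk>u, v\<rbrakk> = \<lbrakk>a, c\<rbrakk> + (\<lbrakk>a, d\<rbrakk> + \<lbrakk>b, c + d\<rbrakk>)"
      by (simp add: ab cd bracket_add_left bracket_add_right)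
    moreover have "\<lbrakk>a, c\<rbrakk> \<in> M" using ab cd M by (simp add: restricted_subalgebra_def subalgebra_def)
    moreover have "\<lbrakk>a, d\<rbrakk> + \<lbrakk>b, c + d\<rbrakk> \<in> I"
      using ab cd I ideal_bracket_left[OF I(1), of b "c + d"]
      by (intro subspace_add subI) (auto simp: ideal_def)
    ultimately show ?thesis by blast
  qed
  show "pmap u \<in> ?S" if u: "u \<in> ?S" for u
  proof -
    obtain a b where ab: "u = a + b" "a \<in> M" "b \<in> I" using u by blast
    have "jacobson_term i a b \<in> I" for i
      using ab(2,3) I ideal_bracket_left[OF I(1)]
      by (intro jacobson_term_mem) (auto simp: ideal_def restricted_subalgebra_def subalgebra_def)
    then have "pmap b + (\<Sum>i = 1..<CHAR('f). jacobson_term i a b) \<in> I"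
      using ab I by (intro subspace_add subspace_sum subI) (auto simp: restricted_subalgebra_def)
    moreover have "pmap a \<in> M" using ab M by (simp add: restricted_subalgebra_def)
    ultimately show ?thesis unfolding ab(1) pmap_add by (auto simp: add.assoc)
  qed
qed

text \<open>\<open>M + I\<close> is a restricted subalgebra strictly above \<open>M\<close>, hence
  everything.\<close>

lemma maximal_sum:
  assumes M: "maximal_restricted_subalgebra M"
    and I: "ideal I" "restricted_subalgebra I" "\<not> I \<subseteq> M"
  obtains m i where "m \<in> M" "i \<in> I" "x = m + i"
proof -
  define S where "S = {x + y | x y. x \<in> M \<and> y \<in> I}"
  have M': "restricted_subalgebra M" using M by (simp add: maximal_restricted_subalgebra_def)
  have 0: "0 \<in> M" "0 \<in> I"
    using M' I(2) restricted_subalgebra_subspace subspace_0 by blast+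
  have "M \<subseteq> S" "I \<subseteq> S" unfolding S_def using 0 by force+
  moreover have "restricted_subalgebra S"
    unfolding S_def using M' I(1,2) by (rule restricted_ideal_sum)
  ultimately have "S = UNIV" using M I(3) unfolding maximal_restricted_subalgebra_def by blast
  then have "x \<in> S" by simp
  then show thesis using that unfolding S_def by blast
qed

lemma restricted_ideal_centralizer:
  assumes "ideal I"
  shows "restricted_subalgebra (centralizer I)"
  using ideal_centralizer[OF assms] bracket_pmap_zero
  by (auto simp: restricted_subalgebra_def subalgebra_def ideal_def centralizer_def)

lemma restricted_subalgebra_Int:
  "restricted_subalgebra S \<Longrightarrow> restricted_subalgebra T \<Longrightarrow> restricted_subalgebra (S \<inter> T)"
  by (simp add: restricted_subalgebra_def subalgebra_def subspace_inter)

lemma restricted_subalgebra_Inter: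
  "\<forall>S\<in>\<S>. restricted_subalgebra S \<Longrightarrow> restricted_subalgebra (\<Inter>\<S>)"
  by (simp add: restricted_subalgebra_def subalgebra_def subspace_Inter)

lemma dually_atomisticE:
  assumes dually_atomistic "restricted_subalgebra S" "x \<notin> S"
  obtains M where "maximal_restricted_subalgebra M" "S \<subseteq> M" "x \<notin> M"
proof -
  obtain \<M> where "\<forall>M\<in>\<M>. maximal_restricted_subalgebra M" "S = \<Inter>\<M>"
    using assms(1,2) unfolding dually_atomistic_def by blast
  with assms(3) that show thesis by blast
qed

lemma ideal_subset_abelian_ideal:
  assumes dually_atomistic
    and B: "ideal B" "restricted_subalgebra B" "B \<subseteq> centralizer B"
    and S: "restricted_subalgebra S" "S \<subseteq> B"
  shows "ideal S"
proof -
  obtain \<M> where \<M>: "\<forall>M\<in>\<M>. maximal_restricted_subalgebra M" "S = \<Inter>\<M>"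
    using assms(1) S(1) unfolding dually_atomistic_def by blast
  have ideal: "ideal (B \<inter> M)" if "M \<in> \<M>" for M
  proof (cases "B \<subseteq> M")
    case True
    then show ?thesis using B(1) by (simp add: Int_absorb2)
  next
    case False
    have M: "maximal_restricted_subalgebra M" using \<M> that by blast
    then have M': "subspace M" "\<And>x y. x \<in> M \<Longrightarrow> y \<in> M \<Longrightarrow> \<lbrakk>x, y\<rbrakk> \<in> M"
      by (auto simp: maximal_restricted_subalgebra_def restricted_subalgebra_def subalgebra_def)
    show ?thesis unfolding ideal_def
    proof (intro conjI allI ballI)
      show "subspace (B \<inter> M)" using B(1) M' by (simp add: ideal_def subspace_inter)
      fix x y assume y: "y \<in> B \<inter> M"
      obtain m b where "m \<in> M" "b \<in> B" "x = m + b" by (rule maximal_sum[OF M B(1,2) False])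
      \<comment> \<open>\<open>b\<close> and \<open>y\<close> lie in the abelian ideal
        \<open>B\<close>, so only \<open>m\<close> acts on \<open>y\<close>.\<close>
      then have "\<lbrakk>x, y\<rbrakk> = \<lbrakk>m, y\<rbrakk>" using y B(3) by (auto simp: bracket_add_left centralizer_def)
      then show "\<lbrakk>x, y\<rbrakk> \<in> B \<inter> M" using \<open>m \<in> M\<close> y M' B(1) by (simp add: ideal_def)
    qed
  qed
  \<comment> \<open>The factor \<open>B\<close> in front covers an empty family, whose intersection
    is the whole algebra.\<close>
  have "S = B \<inter> \<Inter>((\<inter>) B ` \<M>)" using S(2) \<M>(2) by blast
  moreover have "ideal (B \<inter> \<Inter>((\<inter>) B ` \<M>))"
    using ideal B(1) by (intro ideal_Int ideal_Inter) auto
  ultimately show ?thesis by simp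
qed

lemma restricted_subalgebra_span_eigenvector:
  assumes "pmap a = e *s a"
  shows "restricted_subalgebra (span {a})"
  using assms unfolding restricted_subalgebra_def subalgebra_def span_singleton
  by (auto simp: bracket_scale_left bracket_scale_right bracket_self pmap_scale
      subspace_span[of "{a}", unfolded span_singleton] intro: range_eqI[of 0 _ 0])

lemma ex_one_dimensional_restricted_ideal:
  assumes dually_atomistic "solvable_radical \<noteq> {0}"
  obtains a e where "a \<noteq> 0" "e \<in> {0, 1}" "pmap a = e *s a" "ideal (span {a})"
proof -
  obtain J where J: "ideal J" "J \<noteq> {0}" "J \<subseteq> centralizer J"
    using solvable_ideal_abelian_ideal[OF solvable_radical(1,2) assms(2)] by blast
  let ?C = "centralizer J"
  \<comment> \<open>Unlike \<open>J\<close>, the centre of its centralizer is closed under the \<open>p\<close>-map.\<close>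
  define B where "B = ?C \<inter> centralizer ?C"
  have C: "ideal ?C" using J(1) by (rule ideal_centralizer)
  have "J \<subseteq> centralizer ?C" unfolding centralizer_def using bracket_commute_zero by blast
  then have "J \<subseteq> B" using J(3) by (simp add: B_def)
  have B: "ideal B" "restricted_subalgebra B" "B \<subseteq> centralizer B"
    using C J(1) unfolding B_def
    by (auto intro!: ideal_Int ideal_centralizer restricted_subalgebra_Int restricted_ideal_centralizer)
      (auto simp: centralizer_def)
  obtain x where x: "x \<in> B" "x \<noteq> 0"
    using J(1,2) \<open>J \<subseteq> B\<close> subspace_0 unfolding ideal_def by blast
  \<comment> \<open>The last nonzero iterate of the \<open>p\<close>-map on \<open>x\<close> gives
    \<open>e = 0\<close>; if no iterate vanishes, a toral element gives
    \<open>e = 1\<close>.\<close>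
  obtain a e where a: "a \<in> B" "a \<noteq> 0" "e \<in> {0, 1}" "pmap a = e *s a"
  proof (cases "\<exists>n. (pmap ^^ n) x = 0")
    case True
    then obtain n where n: "(pmap ^^ n) x = 0" "\<And>m. m < n \<Longrightarrow> (pmap ^^ m) x \<noteq> 0"
      using exists_least_iff[of "\<lambda>n. (pmap ^^ n) x = 0"] by blast
    then obtain m where "n = Suc m" using x by (cases n) auto
    then show thesis
      using that[of "(pmap ^^ m) x" 0] n pmap_funpow_mem[OF B(2) x(1)] by simp
  next
    case False
    then obtain t where "t \<in> B" "t \<noteq> 0" "pmap t = t"
      using ex_toral_if_not_pmap_nilpotent[OF B(2) x(1)] by blast
    then show thesis using that[of t 1] by simp
  qed
  have "span {a} \<subseteq> B"
    using a(1) B(2) restricted_subalgebra_subspace by (intro span_minimal) auto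
  then have "ideal (span {a})"
    using ideal_subset_abelian_ideal[OF assms(1) B] restricted_subalgebra_span_eigenvector a(4) by blast
  then show thesis using that a by blast
qed

section \<open>Solvability of a dually atomistic algebra with nonzero radical\<close>

theorem solvable_or_semisimple:
  assumes da: dually_atomistic
  shows "solvable UNIV \<or> semisimple"
proof (rule disjCI)
  assume "\<not> semisimple"
  then obtain a e where a: "a \<noteq> 0" "e \<in> {0, 1}" "pmap a = e *s a" "ideal (span {a})"
    using ex_one_dimensional_restricted_ideal[OF da] unfolding semisimple_def by blast
  have A: "restricted_subalgebra (span {a})" using a(3) by (rule restricted_subalgebra_span_eigenvector)
  define C where "C = centralizer (span {a})"
  define \<N> where "\<N> = {M. maximal_restricted_subalgebra M \<and> a \<notin> M}"
  define K where "K = C \<inter> \<Inter>((\<inter>) C ` \<N>)"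
  have C: "ideal C" "restricted_subalgebra C"
    unfolding C_def using a(4) by (rule ideal_centralizer, rule restricted_ideal_centralizer)
  have aC: "\<lbrakk>c, a\<rbrakk> = 0" "\<lbrakk>a, c\<rbrakk> = 0" if "c \<in> C" for c
    using that bracket_commute_zero span_base[of a "{a}"] by (auto simp: C_def centralizer_def)
  have N: "restricted_subalgebra N" "subspace N" "\<And>x y. x \<in> N \<Longrightarrow> y \<in> N \<Longrightarrow> \<lbrakk>x, y\<rbrakk> \<in> N"
    if "N \<in> \<N>" for N
    using that by (auto simp: \<N>_def maximal_restricted_subalgebra_def restricted_subalgebra_def subalgebra_def)
  have N_sum: "\<exists>n k. n \<in> N \<and> x = n + k *s a" if N: "N \<in> \<N>" for N x
  proof -
    have max: "maximal_restricted_subalgebra N" and "\<not> span {a} \<subseteq> N"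
      using N span_base[of a "{a}"] by (auto simp: \<N>_def)
    then obtain n i where "n \<in> N" "i \<in> span {a}" "x = n + i" using maximal_sum[OF max a(4) A] by blast
    then show ?thesis by (auto simp: span_singleton)
  qed
  \<comment> \<open>Although \<open>N\<close> need not be an ideal, \<open>C \<inter> N\<close> is
    one: \<open>L = N + F a\<close>, and \<open>a\<close> acts trivially on
    \<open>C\<close>.\<close>
  have "ideal (C \<inter> N)" if N_mem: "N \<in> \<N>" for N
    unfolding ideal_def
  proof (intro conjI allI ballI)
    show "subspace (C \<inter> N)" using N(2)[OF N_mem] C by (simp add: ideal_def subspace_inter)
    fix x y assume y: "y \<in> C \<inter> N"
    obtain n k where n: "n \<in> N" "x = n + k *s a" using N_sum[OF N_mem] by blast
    then have "\<lbrakk>x, y\<rbrakk> = \<lbrakk>n, y\<rbrakk>" using y aC by (simp add: bracket_add_left bracket_scale_left)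
    then show "\<lbrakk>x, y\<rbrakk> \<in> C \<inter> N" using y N(3)[OF N_mem] n C by (simp add: ideal_def)
  qed
  then have K_ideal: "ideal K" unfolding K_def using C by (intro ideal_Int ideal_Inter) auto
  have K_restricted: "restricted_subalgebra K" unfolding K_def
    using C N(1) by (auto intro!: restricted_subalgebra_Int restricted_subalgebra_Inter)
  have K_eigen: "y = 0" if y: "y \<in> K" "pmap y = e *s y" for y
  proof (rule ccontr)
    assume "y \<noteq> 0"
    have yN: "y \<in> N" if "N \<in> \<N>" for N using y(1) that unfolding K_def by blast
    have "y \<in> C" using y(1) by (simp add: K_def)
    then have "pmap (a + y) = e *s (a + y)"
      using a(3) y(2) aC by (simp add: pmap_add_commute scale_right_distrib)
    then have ay: "restricted_subalgebra (span {a + y})"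
      by (rule restricted_subalgebra_span_eigenvector)
    have "a \<in> span {a + y}"
    proof (rule ccontr)
      assume "a \<notin> span {a + y}"
      then obtain M where M: "maximal_restricted_subalgebra M" "span {a + y} \<subseteq> M" "a \<notin> M"
        by (rule dually_atomisticE[OF da ay])
      then have M': "M \<in> \<N>" by (simp add: \<N>_def)
      have "a + y \<in> M" using M(2) span_base[of "a + y" "{a + y}"] by blast
      then have "a + y - y \<in> M" using yN[OF M'] N(2)[OF M'] by (intro subspace_diff)
      then show False using M(3) by simp
    qed
    then obtain c where c: "a = c *s (a + y)" by (auto simp: span_singleton)
    \<comment> \<open>The relation makes \<open>a\<close> a multiple of \<open>y\<close>, which lies
      in every member of \<open>\<N>\<close>. For a contradiction \<open>\<N>\<close> must be
      nonempty; dual atomisticity for \<open>{0}\<close> shows this.\<close>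
    have zero: "restricted_subalgebra {0}"
      using restricted_subalgebra_span_eigenvector[of 0 0] span_singleton[of 0] by simp
    have "a \<notin> {0}" using a(1) by simp
    then obtain N' where "maximal_restricted_subalgebra N'" "a \<notin> N'"
      by (rule dually_atomisticE[OF da zero])
    then have N': "N' \<in> \<N>" by (simp add: \<N>_def)
    have "c \<noteq> 1" using c \<open>y \<noteq> 0\<close> by (metis add_cancel_left_right scale_one)
    have "c *s a + c *s y = a" using c by (metis scale_right_distrib)
    then have "(1 - c) *s a = c *s y" by (simp add: scale_left_diff_distrib diff_eq_eq add.commute)
    then have "a = (inverse (1 - c) * c) *s y" 
      using \<open>c \<noteq> 1\<close> by (metis right_minus_eq left_inverse scale_one scale_scale)
    then have "a \<in> N'" using yN[OF N'] N(2)[OF N'] subspace_scale by metis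
    then show False using N' by (simp add: \<N>_def)
  qed
  \<comment> \<open>For \<open>e = 0\<close> the \<open>p\<close>-map has trivial kernel on
    \<open>K\<close>; for \<open>e = 1\<close> there are no nonzero toral elements, so some iterate
    of the \<open>p\<close>-map kills \<open>x\<close>.\<close>
  have "ad_nilpotent x" if x: "x \<in> K" for x
  proof (cases "e = 0")
    case True
    then show ?thesis
      using ad_nilpotent_if_no_pmap_kernel[OF K_ideal K_restricted _ x] K_eigen by simp
  next
    case False
    then have "e = 1" using a(2) by simp
    then show ?thesis
      using ex_toral_if_not_pmap_nilpotent[OF K_restricted x] ad_nilpotent_if_pmap_nilpotent K_eigen
      by (metis scale_one)
  qed
  then have "solvable K"
    using K_restricted by (intro engel_solvable) (auto simp: restricted_subalgebra_def)
  moreover have "derived_algebra C \<subseteq> K"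
    unfolding derived_algebra_def
  proof (rule span_minimal)
    show "subspace K" using K_ideal by (simp add: ideal_def)
    \<comment> \<open>As \<open>a\<close> commutes with \<open>x\<close> and \<open>y\<close>, hence
      with \<open>n\<close>, the bracket equals \<open>\<lbrakk>m, n\<rbrakk>\<close>.\<close>
    have "\<lbrakk>x, y\<rbrakk> \<in> N" if "x \<in> C" "y \<in> C" "N \<in> \<N>" for x y N
    proof -
      obtain m j n k where "m \<in> N" "x = m + j *s a" "n \<in> N" "y = n + k *s a"
        using N_sum[OF \<open>N \<in> \<N>\<close>] by metis
      moreover have "\<lbrakk>x, y\<rbrakk> = \<lbrakk>x, n\<rbrakk>"
        using \<open>y = n + k *s a\<close> aC[OF \<open>x \<in> C\<close>] by (simp add: bracket_add_right bracket_scale_right)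
      moreover have "\<lbrakk>a, n\<rbrakk> = 0"
        using aC(2)[OF \<open>y \<in> C\<close>] \<open>y = n + k *s a\<close>
        by (simp add: bracket_add_right bracket_scale_right bracket_self)
      ultimately show ?thesis using N(3)[OF \<open>N \<in> \<N>\<close>] by (simp add: bracket_add_left bracket_scale_left)
    qed
    then show "{\<lbrakk>x, y\<rbrakk> |x y. x \<in> C \<and> y \<in> C} \<subseteq> K"
      using C(1) by (auto simp: K_def ideal_def)
  qed
  ultimately have "solvable C" using solvable_derived by blast
  moreover have "derived_algebra UNIV \<subseteq> C"
    unfolding derived_algebra_def
  proof (rule span_minimal)
    show "subspace C" using C by (simp add: ideal_def)
    \<comment> \<open>Elements act on the line \<open>F a\<close> by scalars, which commute, so
      brackets act as zero.\<close>
    have "\<lbrakk>\<lbrakk>x, y\<rbrakk>, a\<rbrakk> = 0" for x y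
    proof -
      have "\<lbrakk>x, a\<rbrakk> \<in> span {a}" "\<lbrakk>y, a\<rbrakk> \<in> span {a}"
        using a(4) span_base[of a "{a}"] by (auto simp: ideal_def)
      then obtain i j where ij: "\<lbrakk>x, a\<rbrakk> = i *s a" "\<lbrakk>y, a\<rbrakk> = j *s a" by (auto simp: span_singleton)
      have "\<lbrakk>\<lbrakk>x, y\<rbrakk>, a\<rbrakk> = \<lbrakk>x, \<lbrakk>y, a\<rbrakk>\<rbrakk> - \<lbrakk>y, \<lbrakk>x, a\<rbrakk>\<rbrakk>" using leibniz[of x y a] by simp
      then show ?thesis by (simp add: ij bracket_scale_right mult.commute)
    qed
    then show "{\<lbrakk>x, y\<rbrakk> |x y. x \<in> UNIV \<and> y \<in> UNIV} \<subseteq> C"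
      by (auto simp: C_def centralizer_def span_singleton bracket_scale_right)
  qed
  ultimately show "solvable UNIV" using solvable_derived by blast
qed

end

theorem proposition3p2:
  fixes scale :: "'f::alg_closed_field \<Rightarrow> 'l::ab_group_add \<Rightarrow> 'l"
    and bracket :: "'l \<Rightarrow> 'l \<Rightarrow> 'l"
    and pmap :: "'l \<Rightarrow> 'l"
    and Basis :: "'l set"
  assumes "CHAR('f) > 0"
    and "finite_dimensional_vector_space scale Basis"
    and "restricted_lie_algebra scale bracket pmap"
    and "restricted_lie_algebra.dually_atomistic scale bracket pmap"
  shows "lie_algebra.solvable scale bracket UNIV \<or> lie_algebra.semisimple scale bracket"
proof -
  interpret restricted_lie_algebra scale bracket pmap by fact
  interpret finite_dimensional_vector_space scale Basis by fact
  interpret alg_closed_restricted_lie_algebra scale bracket pmap Basis ..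
  show ?thesis using assms(4) by (rule solvable_or_semisimple)
qed

end
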